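(* Let $\tilde P_c\in\mathcal F$ be a feasible power demand. If $\hat P_c\in\mathbb R^n$ satisfies $\hat P_c\le\tilde P_c$ and $\hat P_c\ne\tilde P_c$, then $\hat P_c$ is feasible under small perturbation, i.e., $\hat P_c\in\operatorname{int}(\mathcal F)$.
   Context: Notation: $[x]=\operatorname{diag}(x_1,\dots,x_k)$ for a vector $x$; $\mathbf 0$ is the all-zeros vector; vector inequalities are element-wise. Setting: a DC power grid with $n\ge1$ loads and $m\ge1$ sources. Its Kirchhoff matrix $Y=\begin{pmatrix} Y_{LL} & Y_{LS} \\ Y_{SL} & Y_{SS} \end{pmatrix}\in\mathbb R^{(n+m)\times(n+m)}$ is the weighted Laplacian of a connected undirected graph with positive edge weights (symmetric, nonpositive off-diagonal entries, zero row sums), partitioned according to loads and sources, and the $n\times n$ matrix $Y_{LL}$ is irreducible; hence $Y_{LL}$ is symmetric positive definite with nonpositive off-diagonal entries. The source voltages $V_S\in\mathbb R^m$, $V_S>\mathbf 0$, are fixed. Put $\mathcal I_L^*=-Y_{LS}V_S$ (which satisfies $\mathcal I_L^*\ge\mathbf 0$, $\mathcal I_L^*\ne\mathbf 0$) and $V_L^*=Y_{LL}^{-1}\mathcal I_L^*$ (which satisfies $V_L^*>\mathbf 0$). For $V_L\in\mathbb R^n$ put $P_c(V_L)=[V_L]Y_{LL}(V_L^*-V_L)$. The set of feasible power demands is $\mathcal F=\{P_c(V_L): V_L\in\mathbb R^n,\ V_L>\mathbf 0\}$, with interior $\operatorname{int}(\mathcal F)$ in $\mathbb R^n$. *)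

theory Defs
  imports "HOL-Analysis.Analysis"
begin

text \<open>
  Buses are indexed by the sum type of the loads (\<open>Inl\<close>) and the sources (\<open>Inr\<close>), both finite
  and hence (as types) nonempty.
\<close>

text \<open>The graph is simple, given by its adjacency relation; only the weights of edges matter.\<close>

definition connected_weighted_graph ::
  "('v \<Rightarrow> 'v \<Rightarrow> bool) \<Rightarrow> ('v \<Rightarrow> 'v \<Rightarrow> real) \<Rightarrow> bool" where
  "connected_weighted_graph E w \<longleftrightarrow>
     symp E \<and> irreflp E \<and> (\<forall>u v. E\<^sup>*\<^sup>* u v) \<and>
     (\<forall>u v. E u v \<longrightarrow> 0 < w u v \<and> w u v = w v u)"

definition weighted_laplacian ::
  "('v \<Rightarrow> 'v \<Rightarrow> bool) \<Rightarrow> ('v \<Rightarrow> 'v \<Rightarrow> real) \<Rightarrow> real^'v::finite^'v" where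
  "weighted_laplacian E w =
     (\<chi> u v. if u = v then \<Sum>k | E u k. w u k else if E u v then - w u v else 0)"

definition kirchhoff_matrix :: "real^'v::finite^'v \<Rightarrow> bool" where
  "kirchhoff_matrix Y \<longleftrightarrow> (\<exists>E w. connected_weighted_graph E w \<and> Y = weighted_laplacian E w)"

definition Y_LL :: "real^('n::finite + 'm::finite)^('n + 'm) \<Rightarrow> real^'n^'n" where
  "Y_LL Y = (\<chi> i j. Y $ Inl i $ Inl j)"

definition Y_LS :: "real^('n::finite + 'm::finite)^('n + 'm) \<Rightarrow> real^'m^'n" where
  "Y_LS Y = (\<chi> i j. Y $ Inl i $ Inr j)"

text \<open>
  A matrix is reducible if some simultaneous permutation of rows and columns makes it block
  triangular with two nonempty diagonal blocks; over an unordered index type such a permutation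
  amounts to a choice of the index set \<open>S\<close> of one block.
\<close>

definition irreducible_matrix :: "real^'n^'n \<Rightarrow> bool" where
  "irreducible_matrix A \<longleftrightarrow>
     \<not> (\<exists>S. S \<noteq> {} \<and> S \<noteq> UNIV \<and> (\<forall>i\<in>S. \<forall>j\<in>-S. A $ i $ j = 0))"

text \<open>
  The library's strict order on vectors is not element-wise (it means \<open>x \<le> y \<and> \<not> y \<le> x\<close>),
  hence a separate predicate for \<open>x > 0\<close> element-wise; the library's \<open>\<le>\<close> is element-wise.
\<close>

definition positive_vec :: "real^'n \<Rightarrow> bool" where
  "positive_vec x \<longleftrightarrow> (\<forall>i. 0 < x $ i)"

definition diag_matrix :: "real^'n \<Rightarrow> real^'n^'n" where
  "diag_matrix x = (\<chi> i j. if i = j then x $ i else 0)"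

definition I_L_star :: "real^('n::finite + 'm::finite)^('n + 'm) \<Rightarrow> real^'m \<Rightarrow> real^'n" where
  "I_L_star Y V\<^sub>S = - (Y_LS Y *v V\<^sub>S)"

definition V_L_star :: "real^('n::finite + 'm::finite)^('n + 'm) \<Rightarrow> real^'m \<Rightarrow> real^'n" where
  "V_L_star Y V\<^sub>S = matrix_inv (Y_LL Y) *v I_L_star Y V\<^sub>S"

definition P_c :: "real^('n::finite + 'm::finite)^('n + 'm) \<Rightarrow> real^'m \<Rightarrow> real^'n \<Rightarrow> real^'n" where
  "P_c Y V\<^sub>S V\<^sub>L = (diag_matrix V\<^sub>L ** Y_LL Y) *v (V_L_star Y V\<^sub>S - V\<^sub>L)"

definition feasible_demands :: "real^('n::finite + 'm::finite)^('n + 'm) \<Rightarrow> real^'m \<Rightarrow> (real^'n) set" where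
  "feasible_demands Y V\<^sub>S = {P_c Y V\<^sub>S V\<^sub>L | V\<^sub>L. positive_vec V\<^sub>L}"

end

(* Write A = Y_LL and b = I_L_star, so that P_c V has the entries V_i (b_i - (A V)_i). As A has
   nonpositive off-diagonal entries, raising the voltages on a set S of loads does not lower the
   demand at the loads outside S, and raises it at those adjacent to S.

   If P \<le> P_c V, a maximiser of the total voltage over {W. V \<le> W, P \<le> P_c W}, which is compact
   because A is positive definite, must satisfy P_c W = P, since otherwise its voltages could be
   raised slightly where P < P_c W. So the feasible set is downward closed. If moreover
   P < P_c V on a nonempty set S of loads, raising the voltages slightly on S makes the inequality
   strict also at a neighbour of S, which exists by irreducibility. Iterating, P lies strictly
   below a feasible demand in every entry, and then so does a neighbourhood of P. *)

theory Submission
  imports Defs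
begin

section \<open>Power demands for a general matrix and the effect of raising voltages\<close>

text \<open>This is \<open>P_c\<close> with the product of \<open>Y_LL\<close> and
  \<open>V_L_star\<close> multiplied out to \<open>b\<close>, so that no matrix inverse occurs;
  \<open>P_c_eq_power_demand\<close> justifies it.\<close>

definition power_demand :: "real^'n^'n \<Rightarrow> real^'n \<Rightarrow> real^'n \<Rightarrow> real^'n" where
  "power_demand A b V = (\<chi> i. V $ i * (b $ i - (A *v V) $ i))"

definition strict_indices :: "real^'n \<Rightarrow> real^'n \<Rightarrow> 'n set" where
  "strict_indices x y = {i. x $ i < y $ i}"

definition z_matrix :: "real^'n^'n \<Rightarrow> bool" where
  "z_matrix A \<longleftrightarrow> (\<forall>i j. i \<noteq> j \<longrightarrow> A $ i $ j \<le> 0)"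

lemma vec_eq_if_le_no_strict_indices:
  fixes x y :: "real^'n"
  assumes "x \<le> y" "strict_indices x y = {}"
  shows "x = y"
  using assms by (auto simp: vec_eq_iff less_eq_vec_def strict_indices_def order.order_iff_strict)

lemma positive_vec_mono:
  assumes "positive_vec x" "x \<le> y"
  shows "positive_vec y"
  using assms unfolding positive_vec_def less_eq_vec_def by (meson less_le_trans)

lemma continuous_on_power_demand:
  fixes A :: "real^'n^'n"
  shows "continuous_on S (power_demand A b)"
  unfolding power_demand_def matrix_vector_mult_def
  by (intro continuous_intros)

text \<open>All voltages on the strict set are raised by one small amount \<open>e\<close>.
  Strictness there survives by continuity; outside, the demand changes by a term whose sign the
  off-diagonal entries decide.\<close>

lemma exists_raise:
  fixes A :: "real^'n^'n" and V P :: "real^'n"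
  assumes Z: "z_matrix A" and V: "positive_vec V" and P: "P \<le> power_demand A b V"
    and ne: "strict_indices P (power_demand A b V) \<noteq> {}"
  obtains W where "V \<le> W" "V \<noteq> W" "P \<le> power_demand A b W"
    "strict_indices P (power_demand A b V) \<subseteq> strict_indices P (power_demand A b W)"
    "\<And>i j. j \<in> strict_indices P (power_demand A b V) \<Longrightarrow> i \<notin> strict_indices P (power_demand A b V)
      \<Longrightarrow> A $ i $ j \<noteq> 0 \<Longrightarrow> i \<in> strict_indices P (power_demand A b W)"
proof -
  define S where "S = strict_indices P (power_demand A b V)"
  define d :: "real^'n" where "d = (\<chi> i. if i \<in> S then 1 else 0)"
  define g where "g e = power_demand A b (V + e *\<^sub>R d)" for e
  have cont: "continuous_on UNIV (\<lambda>e. g e $ i)" for i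
    unfolding g_def
    by (intro continuous_intros continuous_on_compose2[OF continuous_on_power_demand[of UNIV]]) auto
  have "(\<lambda>e. g e $ i) \<midarrow>0\<rightarrow> g 0 $ i" for i
    using cont[of i] by (simp add: continuous_on_def)
  \<comment> \<open>The limit is one-sided because \<open>e\<close> has to be positive; finiteness
    of \<open>S\<close> then lets a single \<open>e\<close> serve all its members.\<close>
  then have tend: "((\<lambda>e. g e $ i) \<longlongrightarrow> g 0 $ i) (at_right 0)" for i
    by (rule filterlim_mono) (auto simp: at_le)
  have "\<forall>\<^sub>F e in at_right 0. \<forall>i\<in>S. P $ i < g e $ i"
    by (intro eventually_ball_finite ballI order_tendstoD(1)[OF tend])
       (auto simp: S_def strict_indices_def g_def)
  moreover have "\<forall>\<^sub>F e in at_right 0. (0::real) < e"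
    by (simp add: eventually_at_right_less)
  ultimately have "\<forall>\<^sub>F e in at_right 0. (\<forall>i\<in>S. P $ i < g e $ i) \<and> 0 < e"
    by (rule eventually_conj)
  then obtain e where e: "\<And>i. i \<in> S \<Longrightarrow> P $ i < g e $ i" "0 < e"
    using eventually_happens'[OF trivial_limit_at_right_real] by blast
  define W where "W = V + e *\<^sub>R d"
  have Ad: "(A *v d) $ i = (\<Sum>j\<in>S. A $ i $ j)" for i
    by (simp add: matrix_vector_mult_def d_def if_distrib sum.If_cases cong: if_cong)
  \<comment> \<open>Off \<open>S\<close> the voltage itself is unchanged, so the demand is exactly
    affine in \<open>e\<close> and the sign argument needs no smallness of \<open>e\<close>.\<close>
  have out: "power_demand A b W $ i = power_demand A b V $ i - V $ i * e * (\<Sum>j\<in>S. A $ i $ j)"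
    if "i \<notin> S" for i
    using that
    by (simp add: power_demand_def W_def matrix_vector_right_distrib matrix_vector_mult_scaleR Ad)
       (simp add: d_def algebra_simps)
  have nonpos: "A $ i $ j \<le> 0" if "i \<notin> S" "j \<in> S" for i j
    using Z that unfolding z_matrix_def by metis
  have Vpos: "0 < V $ i" for i
    using V by (simp add: positive_vec_def)
  have "V \<le> W"
    using e(2) by (simp add: W_def d_def less_eq_vec_def)
  moreover have "V \<noteq> W"
    using e(2) ne by (auto simp: W_def d_def vec_eq_iff S_def[symmetric])
  moreover have SW: "S \<subseteq> strict_indices P (power_demand A b W)"
    using e(1) by (auto simp: strict_indices_def W_def g_def)
  moreover have "P \<le> power_demand A b W"
    unfolding less_eq_vec_def
  proof
    fix i
    show "P $ i \<le> power_demand A b W $ i"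
    proof (cases "i \<in> S")
      case True
      then show ?thesis using SW by (auto simp: strict_indices_def intro: less_imp_le)
    next
      case False
      have "V $ i * e * (\<Sum>j\<in>S. A $ i $ j) \<le> 0"
        using Vpos[of i] e(2) nonpos[OF False] by (intro mult_nonneg_nonpos sum_nonpos) auto
      moreover have "P $ i \<le> power_demand A b V $ i"
        using P by (simp add: less_eq_vec_def)
      ultimately show ?thesis by (simp add: out[OF False])
    qed
  qed
  moreover have "i \<in> strict_indices P (power_demand A b W)"
    if "j \<in> S" "i \<notin> S" "A $ i $ j \<noteq> 0" for i j
  proof -
    have "(\<Sum>k\<in>S. - A $ i $ k) > 0"
      using that nonpos[OF that(2)] by (intro sum_pos2[of S j]) (auto simp: less_le)
    then have "V $ i * e * (\<Sum>k\<in>S. A $ i $ k) < 0"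
      using Vpos[of i] e(2) by (intro mult_pos_neg) (auto simp: sum_negf)
    moreover have "P $ i \<le> power_demand A b V $ i"
      using P by (simp add: less_eq_vec_def)
    ultimately show ?thesis by (simp add: out[OF that(2)] strict_indices_def)
  qed
  ultimately show ?thesis
    using that unfolding S_def by blast
qed

section \<open>Compactness and downward closure\<close>

text \<open>The constant is the minimum of the quadratic form on the unit sphere; homogeneity of
  degree 2 carries the bound to all vectors.\<close>

lemma positive_definite_coercive:
  fixes A :: "real^'n^'n"
  assumes pd: "\<And>x. x \<noteq> 0 \<Longrightarrow> 0 < x \<bullet> (A *v x)"
  obtains c where "0 < c" "\<And>x. c * (norm x)\<^sup>2 \<le> x \<bullet> (A *v x)"
proof -
  have "continuous_on (sphere 0 1) (\<lambda>x. x \<bullet> (A *v x))"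
    by (intro continuous_intros linear_continuous_on linear_linear[THEN iffD2] matrix_vector_mul_linear)
  moreover have "sphere (0::real^'n) 1 \<noteq> {}"
    by simp
  ultimately obtain z where z: "z \<in> sphere 0 1"
    "\<And>x. x \<in> sphere 0 1 \<Longrightarrow> z \<bullet> (A *v z) \<le> x \<bullet> (A *v x)"
    using continuous_attains_inf[OF compact_sphere, of 0 1 "\<lambda>x. x \<bullet> (A *v x)"] by blast
  show ?thesis
  proof
    show "0 < z \<bullet> (A *v z)"
      using z(1) by (intro pd) auto
    show "z \<bullet> (A *v z) * (norm x)\<^sup>2 \<le> x \<bullet> (A *v x)" for x
    proof (cases "x = 0")
      case False
      have "z \<bullet> (A *v z) \<le> (x /\<^sub>R norm x) \<bullet> (A *v (x /\<^sub>R norm x))"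
        using False by (intro z(2)) simp
      also have "\<dots> = (x \<bullet> (A *v x)) / (norm x)\<^sup>2"
        by (simp add: matrix_vector_mult_scaleR power2_eq_square divide_inverse)
      finally show ?thesis
        using False by (simp add: field_simps)
    qed simp
  qed
qed

text \<open>Summing the entries turns the demand into
  \<open>V \<bullet> b - V \<bullet> (A *v V)\<close>, whose coercive quadratic part forces the
  total below that of \<open>P\<close> once \<open>V\<close> is large.\<close>

lemma bounded_power_demand_ge:
  fixes A :: "real^'n^'n"
  assumes "\<And>x. x \<noteq> 0 \<Longrightarrow> 0 < x \<bullet> (A *v x)"
  shows "bounded {V. P \<le> power_demand A b V}"
proof -
  obtain c where c: "0 < c" "\<And>x. c * (norm x)\<^sup>2 \<le> x \<bullet> (A *v x)"
    using positive_definite_coercive assms by blast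
  define B where "B = norm b + \<bar>\<Sum>i\<in>UNIV. P $ i\<bar>"
  show ?thesis
    unfolding bounded_iff
  proof (intro exI ballI)
    fix V assume "V \<in> {V. P \<le> power_demand A b V}"
    then have "(\<Sum>i\<in>UNIV. P $ i) \<le> (\<Sum>i\<in>UNIV. power_demand A b V $ i)"
      by (intro sum_mono) (auto simp: less_eq_vec_def)
    also have "\<dots> = V \<bullet> b - V \<bullet> (A *v V)"
      by (simp add: power_demand_def inner_vec_def algebra_simps sum_subtractf)
    finally have "c * (norm V)\<^sup>2 \<le> norm V * norm b + \<bar>\<Sum>i\<in>UNIV. P $ i\<bar>"
      using c(2)[of V] norm_cauchy_schwarz[of V b] by linarith
    show "norm V \<le> max 1 (B / c)"
    \<comment> \<open>Beyond norm 1 the constant term is at most \<open>norm V\<close> times itself,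
      so one factor \<open>norm V\<close> cancels throughout.\<close>
    proof (cases "norm V \<le> 1")
      case False
      have "c * (norm V)\<^sup>2 \<le> norm V * norm b + \<bar>\<Sum>i\<in>UNIV. P $ i\<bar>" by fact
      also have "\<dots> \<le> norm V * norm b + norm V * \<bar>\<Sum>i\<in>UNIV. P $ i\<bar>"
        using False mult_right_mono[of 1 "norm V" "\<bar>\<Sum>i\<in>UNIV. P $ i\<bar>"] by simp
      also have "\<dots> = norm V * B"
        by (simp add: B_def algebra_simps)
      finally have "norm V * (c * norm V) \<le> norm V * B"
        by (simp add: power2_eq_square algebra_simps)
      then have "c * norm V \<le> B"
        by (rule mult_left_le_imp_le) (use False in linarith)
      then show ?thesis
        using c(1) by (simp add: field_simps le_max_iff_disj)
    qed simp
  qed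
qed

lemma power_demand_downward_closed:
  fixes A :: "real^'n^'n"
  assumes pd: "\<And>x. x \<noteq> 0 \<Longrightarrow> 0 < x \<bullet> (A *v x)" and Z: "z_matrix A"
    and V: "positive_vec V" and P: "P \<le> power_demand A b V"
  obtains W where "positive_vec W" "power_demand A b W = P"
proof -
  \<comment> \<open>The bound \<open>V \<le> W\<close> is a closed condition that still guarantees
    positive voltages; positivity alone would not give a closed set.\<close>
  define K where "K = {W. V \<le> W} \<inter> {W. P \<le> power_demand A b W}"
  have "closed {W. V \<le> W}"
    unfolding less_eq_vec_def by (intro closed_Collect_all closed_Collect_le continuous_intros)
  moreover have "closed {W. P \<le> power_demand A b W}"
    unfolding less_eq_vec_def
    by (intro closed_Collect_all closed_Collect_le continuous_on_const continuous_on_component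
        continuous_on_power_demand)
  ultimately have "closed K"
    unfolding K_def by (rule closed_Int)
  moreover have "bounded K"
    unfolding K_def using bounded_power_demand_ge[OF pd] by (rule bounded_subset) auto
  ultimately have "compact K"
    by (simp add: compact_eq_bounded_closed)
  moreover have "V \<in> K"
    using P by (simp add: K_def)
  moreover have "continuous_on K (\<lambda>W. \<Sum>i\<in>UNIV. W $ i)"
    by (intro continuous_intros)
  ultimately obtain W where W: "W \<in> K" "\<And>U. U \<in> K \<Longrightarrow> (\<Sum>i\<in>UNIV. U $ i) \<le> (\<Sum>i\<in>UNIV. W $ i)"
    using continuous_attains_sup[of K "\<lambda>W. \<Sum>i\<in>UNIV. W $ i"] by blast
  have VW: "V \<le> W" and PW: "P \<le> power_demand A b W"
    using W(1) by (auto simp: K_def)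
  have posW: "positive_vec W"
    using V VW by (rule positive_vec_mono)
  have "strict_indices P (power_demand A b W) = {}"
  proof (rule ccontr)
    assume "strict_indices P (power_demand A b W) \<noteq> {}"
    then obtain U where U: "W \<le> U" "W \<noteq> U" "P \<le> power_demand A b U"
      by (rule exists_raise[OF Z posW PW])
    then have "U \<in> K"
      using VW by (auto simp: K_def)
    \<comment> \<open>The total voltage is strictly monotone in the element-wise order, so any raise
      inside \<open>K\<close> contradicts the choice of \<open>W\<close>.\<close>
    moreover have "(\<Sum>i\<in>UNIV. W $ i) < (\<Sum>i\<in>UNIV. U $ i)"
      using U(1,2) by (intro sum_strict_mono_ex1) (auto simp: less_eq_vec_def vec_eq_iff less_le)
    ultimately show False
      using W(2) by fastforce
  qed
  then have "P = power_demand A b W"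
    by (rule vec_eq_if_le_no_strict_indices[OF PW])
  with posW show ?thesis
    using that by simp
qed

section \<open>Spreading strictness to all loads\<close>

lemma exists_power_demand_strictly_above:
  fixes A :: "real^'n^'n"
  assumes irr: "irreducible_matrix A" and Z: "z_matrix A"
    and "positive_vec V" "P \<le> power_demand A b V" "P \<noteq> power_demand A b V"
  obtains W where "positive_vec W" "\<And>i. P $ i < power_demand A b W $ i"
proof -
  have "\<exists>W. positive_vec W \<and> strict_indices P (power_demand A b W) = UNIV"
    if "positive_vec V" "P \<le> power_demand A b V" "strict_indices P (power_demand A b V) \<noteq> {}" for V
    using that
  \<comment> \<open>The induction is on the number of loads where the inequality is not yet strict;
    each raise lowers it.\<close>
  proof (induction "card (- strict_indices P (power_demand A b V))" arbitrary: V rule: less_induct)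
    case less
    show ?case
    proof (cases "strict_indices P (power_demand A b V) = UNIV")
      case False
      let ?S = "strict_indices P (power_demand A b V)"
      obtain W where W: "V \<le> W" "P \<le> power_demand A b W"
        "?S \<subseteq> strict_indices P (power_demand A b W)"
        "\<And>i j. j \<in> ?S \<Longrightarrow> i \<notin> ?S \<Longrightarrow> A $ i $ j \<noteq> 0 \<Longrightarrow> i \<in> strict_indices P (power_demand A b W)"
        using exists_raise[OF Z less.prems] by metis
      \<comment> \<open>Irreducibility is applied to the complement of \<open>?S\<close>, so that
        the nonzero entry has its row outside \<open>?S\<close> and its column inside, as
        \<open>W(4)\<close> requires.\<close>
      have "- ?S \<noteq> {}" "- ?S \<noteq> UNIV"
        using False less.prems(3) by auto
      then obtain i j where ij: "i \<notin> ?S" "j \<in> ?S" "A $ i $ j \<noteq> 0"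
        using irr unfolding irreducible_matrix_def by (metis Compl_iff)
      have "i \<in> strict_indices P (power_demand A b W)"
        using W(4) ij by blast
      then have "- strict_indices P (power_demand A b W) \<subset> - ?S"
        using W(3) ij by blast
      then have "card (- strict_indices P (power_demand A b W)) < card (- ?S)"
        by (intro psubset_card_mono) auto
      moreover have "positive_vec W"
        using less.prems(1) W(1) by (rule positive_vec_mono)
      ultimately show ?thesis
        using less.hyps[of W] W(2,3) less.prems(3) by auto
    qed (use less.prems in blast)
  qed
  moreover have "strict_indices P (power_demand A b V) \<noteq> {}"
    using vec_eq_if_le_no_strict_indices assms(4,5) by blast
  ultimately obtain W where "positive_vec W" "strict_indices P (power_demand A b W) = UNIV"
    using assms(3,4) by blast
  then show ?thesis
    using that by (auto simp: strict_indices_def)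
qed

section \<open>Positive definiteness of the load block\<close>

text \<open>Swapping \<open>u\<close> and \<open>v\<close> and adding the two sums completes the
  square; hence the factor 2.\<close>

lemma laplacian_quadratic_form:
  fixes a :: "'v::finite \<Rightarrow> 'v \<Rightarrow> real"
  assumes sym: "\<And>u v. a u v = a v u"
  shows "2 * (\<Sum>u\<in>UNIV. y u * (\<Sum>v\<in>UNIV. a u v * (y u - y v))) =
    (\<Sum>u\<in>UNIV. \<Sum>v\<in>UNIV. a u v * (y u - y v)\<^sup>2)"
proof -
  let ?Q = "\<Sum>u\<in>UNIV. \<Sum>v\<in>UNIV. y u * (a u v * (y u - y v))"
  have "?Q = (\<Sum>u\<in>UNIV. \<Sum>v\<in>UNIV. y v * (a u v * (y v - y u)))"
    by (subst sum.swap) (simp add: sym)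
  then have "2 * ?Q = (\<Sum>u\<in>UNIV. \<Sum>v\<in>UNIV. y u * (a u v * (y u - y v)) + y v * (a u v * (y v - y u)))"
    by (simp add: sum.distrib)
  also have "\<dots> = (\<Sum>u\<in>UNIV. \<Sum>v\<in>UNIV. a u v * (y u - y v)\<^sup>2)"
    by (intro sum.cong refl) (simp add: power2_eq_square algebra_simps)
  finally show ?thesis
    by (simp add: sum_distrib_left)
qed

lemma z_matrix_Y_LL:
  assumes "kirchhoff_matrix Y"
  shows "z_matrix (Y_LL Y)"
  using assms
  by (auto simp: z_matrix_def Y_LL_def kirchhoff_matrix_def weighted_laplacian_def
      connected_weighted_graph_def less_imp_le)

text \<open>Extended by zero to the sources, \<open>x\<close> has the Laplacian energy of the whole
  graph. Zero energy makes the extension constant by connectedness, and it vanishes at a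
  source.\<close>

lemma positive_definite_Y_LL:
  fixes Y :: "real^('n::finite + 'm::finite)^('n + 'm)" and x :: "real^'n"
  assumes "kirchhoff_matrix Y" "x \<noteq> 0"
  shows "0 < x \<bullet> (Y_LL Y *v x)"
proof -
  obtain E w where G: "connected_weighted_graph E w" and Y: "Y = weighted_laplacian E w"
    using assms(1) by (auto simp: kirchhoff_matrix_def)
  \<comment> \<open>The weights \<open>w\<close> are constrained on edges only; cutting them off
    elsewhere makes symmetry and nonnegativity hold for all pairs.\<close>
  define a where "a u v = (if E u v then w u v else 0)" for u v
  define y where "y u = (case u of Inl i \<Rightarrow> x $ i | Inr _ \<Rightarrow> 0)" for u :: "'n + 'm"
  have sym: "a u v = a v u" and nonneg: "0 \<le> a u v" and refl: "a u u = 0" for u v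
    using G by (auto simp: a_def connected_weighted_graph_def symp_def irreflp_def less_imp_le)
  have Yuv: "Y $ u $ v = (if u = v then \<Sum>k\<in>UNIV. a u k else 0) - a u v" for u v
    using refl[of u] by (auto simp: Y weighted_laplacian_def a_def sum.If_cases)
  have Yy: "(\<Sum>v\<in>UNIV. Y $ u $ v * y v) = (\<Sum>v\<in>UNIV. a u v * (y u - y v))" for u
    by (simp add: Yuv left_diff_distrib right_diff_distrib sum_subtractf sum_distrib_right
        if_distrib[of "\<lambda>z. z * _"] cong: if_cong)
  have sum_split: "(\<Sum>u\<in>UNIV. f u) = (\<Sum>i\<in>UNIV. f (Inl i)) + (\<Sum>i\<in>UNIV. f (Inr i))"
    for f :: "'n + 'm \<Rightarrow> real"
    by (simp add: UNIV_Plus_UNIV[symmetric] sum.Plus del: UNIV_Plus_UNIV)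
  have "x \<bullet> (Y_LL Y *v x) = (\<Sum>u\<in>UNIV. y u * (\<Sum>v\<in>UNIV. Y $ u $ v * y v))"
    by (simp add: sum_split y_def inner_vec_def matrix_vector_mult_def Y_LL_def)
  then have Q: "2 * (x \<bullet> (Y_LL Y *v x)) = (\<Sum>u\<in>UNIV. \<Sum>v\<in>UNIV. a u v * (y u - y v)\<^sup>2)"
    using laplacian_quadratic_form[of a y, OF sym] by (simp add: Yy)
  have "(\<Sum>u\<in>UNIV. \<Sum>v\<in>UNIV. a u v * (y u - y v)\<^sup>2) \<noteq> 0"
  proof
    assume "(\<Sum>u\<in>UNIV. \<Sum>v\<in>UNIV. a u v * (y u - y v)\<^sup>2) = 0"
    then have "\<forall>u v. a u v * (y u - y v)\<^sup>2 = 0"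
      using nonneg by (simp add: sum_nonneg_eq_0_iff sum_nonneg)
    then have edge: "y u = y v" if "E u v" for u v
      using that G by (force simp: a_def connected_weighted_graph_def)
    have "y u = y v" if "E\<^sup>*\<^sup>* u v" for u v
      using that by induction (auto dest: edge)
    \<comment> \<open>\<open>undefined\<close> merely names some source, since the type of sources
      is nonempty.\<close>
    then have "y (Inl i) = y (Inr undefined)" for i
      using G unfolding connected_weighted_graph_def by blast
    then show False
      using assms(2) by (simp add: y_def vec_eq_iff)
  qed
  moreover have "0 \<le> (\<Sum>u\<in>UNIV. \<Sum>v\<in>UNIV. a u v * (y u - y v)\<^sup>2)"
    by (intro sum_nonneg mult_nonneg_nonneg nonneg) auto
  ultimately show ?thesis
    using Q by linarith
qed

lemma positive_definite_invertible:
  fixes A :: "real^'n^'n"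
  assumes "\<And>x. x \<noteq> 0 \<Longrightarrow> 0 < x \<bullet> (A *v x)"
  shows "invertible A"
proof -
  have "\<forall>x. A *v x = 0 \<longrightarrow> x = 0"
    using assms by (metis inner_zero_right less_irrefl)
  then show ?thesis
    using matrix_left_invertible_ker[of A] invertible_left_inverse[of A] by blast
qed

section \<open>Return to the grid\<close>

lemma P_c_eq_power_demand:
  fixes Y :: "real^('n::finite + 'm::finite)^('n + 'm)"
  assumes "kirchhoff_matrix Y"
  shows "P_c Y V\<^sub>S V = power_demand (Y_LL Y) (I_L_star Y V\<^sub>S) V"
proof -
  have "invertible (Y_LL Y)"
    using positive_definite_Y_LL[OF assms] by (rule positive_definite_invertible)
  \<comment> \<open>\<open>matrix_inv\<close> is a Hilbert choice, so it is an inverse only once one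
    is known to exist.\<close>
  then have "Y_LL Y ** matrix_inv (Y_LL Y) = mat 1"
    unfolding invertible_def matrix_inv_def by (rule someI_ex[THEN conjunct1])
  then have "Y_LL Y *v V_L_star Y V\<^sub>S = I_L_star Y V\<^sub>S"
    by (simp add: V_L_star_def matrix_vector_mul_assoc)
  then have "P_c Y V\<^sub>S V = diag_matrix V *v (I_L_star Y V\<^sub>S - Y_LL Y *v V)"
    by (simp add: P_c_def matrix_vector_mul_assoc[symmetric] matrix_vector_mult_diff_distrib)
  then show ?thesis
    by (simp add: vec_eq_iff power_demand_def diag_matrix_def matrix_vector_mult_def[of "\<chi> i j. _ i j"]
        if_distrib[of "\<lambda>z. z * _"] cong: if_cong)
qed

theorem lemma4p1:
  fixes Y :: "real^('n::finite + 'm::finite)^('n + 'm)"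
    and V\<^sub>S :: "real^'m"
    and P_tilde P_hat :: "real^'n"
  assumes "kirchhoff_matrix Y"
    and "irreducible_matrix (Y_LL Y)"
    and "positive_vec V\<^sub>S"
    and "P_tilde \<in> feasible_demands Y V\<^sub>S"
    and "P_hat \<le> P_tilde"
    and "P_hat \<noteq> P_tilde"
  shows "P_hat \<in> interior (feasible_demands Y V\<^sub>S)"
proof -
  let ?p = "power_demand (Y_LL Y) (I_L_star Y V\<^sub>S)"
  have F: "feasible_demands Y V\<^sub>S = {?p V | V. positive_vec V}"
    by (simp add: feasible_demands_def P_c_eq_power_demand[OF assms(1)])
  obtain V where "positive_vec V" "P_tilde = ?p V"
    using assms(4) F by auto
  then obtain W where W: "positive_vec W" "\<And>i. P_hat $ i < ?p W $ i"
    using exists_power_demand_strictly_above[OF assms(2) z_matrix_Y_LL[OF assms(1)]] assms(5,6)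
    by metis
  \<comment> \<open>This open set contains \<open>P_hat\<close> and, by downward closure from
    \<open>W\<close>, only feasible demands.\<close>
  define U where "U = {P. \<forall>i. P $ i < ?p W $ i}"
  have "open U"
    unfolding U_def Collect_all_eq by (intro open_INT ballI open_Collect_less continuous_intros) simp
  moreover have "P_hat \<in> U"
    using W(2) by (simp add: U_def)
  moreover have "U \<subseteq> feasible_demands Y V\<^sub>S"
  proof
    fix P assume "P \<in> U"
    then have "P \<le> ?p W"
      by (simp add: U_def less_eq_vec_def less_imp_le)
    then obtain V where "positive_vec V" "?p V = P"
      using power_demand_downward_closed[OF positive_definite_Y_LL[OF assms(1)]
          z_matrix_Y_LL[OF assms(1)] W(1)] by blast
    then show "P \<in> feasible_demands Y V\<^sub>S"
      using F by auto
  qed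
  ultimately show ?thesis
    by (rule interiorI)
qed

end
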